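(* Let $p,q\ge 0$ be integers with $n=p+q$, let $\mu\in C\ell_{p,q}$ satisfy $\mu^2=-1$, and let $f,g\in L^1(\mathbb{R},C\ell_{p,q})$. Write $g=\sum_{\Sigma\subseteq\{1,\dots,n\}} e_\Sigma\, g_\Sigma$ with real-valued coefficient functions $g_\Sigma$. Then for every $\xi\in\mathbb{R}$, $$\mathcal{F}^\mu(f*g)(\xi)=\sum_{\Sigma\subseteq\{1,\dots,n\}}\mathcal{F}^\mu(f e_\Sigma)(\xi)\,\mathcal{F}^\mu(g_\Sigma)(\xi).$$
   Context: $C\ell_{p,q}$ is the real associative Clifford algebra generated by $e_1,\dots,e_n$ ($n=p+q$) subject to $e_\ell e_k+e_k e_\ell=2\delta_{\ell,k}\varepsilon_\ell$, where $\varepsilon_\ell=1$ for $1\le\ell\le p$ and $\varepsilon_\ell=-1$ for $p+1\le\ell\le n$. It has real dimension $2^n$ with basis $e_\Sigma=e_{\sigma_1}\cdots e_{\sigma_\ell}$, for $\Sigma=\{\sigma_1<\dots<\sigma_\ell\}\subseteq\{1,\dots,n\}$, and $e_\emptyset=1$. The modulus of $\mathcal{C}=\sum_\Sigma \mathcal{C}_\Sigma e_\Sigma$ (with $\mathcal{C}_\Sigma\in\mathbb{R}$) is $|\mathcal{C}|=\big(\sum_\Sigma \mathcal{C}_\Sigma^2\big)^{1/2}$, and $L^1(\mathbb{R},C\ell_{p,q})$ is the space of integrable $C\ell_{p,q}$-valued functions (all real coefficient functions are in $L^1(\mathbb{R})$); integrals are taken coefficientwise. For $\mu\in C\ell_{p,q}$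 with $\mu^2=-1$ and $\theta\in\mathbb{R}$, $e^{\mu\theta}=\cos\theta+\mu\sin\theta$. The general one-dimensional Clifford Fourier transform of $f\in L^1(\mathbb{R},C\ell_{p,q})$ with respect to $\mu$ is $$\mathcal{F}^\mu(f)(\xi)=\int_{\mathbb{R}} f(x)e^{\mu x\xi}\,dx,\qquad \xi\in\mathbb{R}$$ (exponential multiplied on the right). The convolution of $f,g\in L^1(\mathbb{R},C\ell_{p,q})$ is $(f*g)(y)=\int_{\mathbb{R}} f(x)g(y-x)\,dx$, with the product taken in $C\ell_{p,q}$ in this order. *)

theory Defs
  imports "HOL-Analysis.Analysis" "HOL-Library.Poly_Mapping"
begin

section \<open>The Clifford algebra of signature (p, q)\<close>

text \<open>
  A multivector is a finitely supported real function on index sets; the coefficient of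
  the basis element indexed by \<open>S\<close> is \<open>cl_coeff u S\<close>, and \<open>Poly_Mapping.single S c\<close> is \<open>c\<close> times
  that basis element. The algebra of signature \<open>(p, q)\<close> consists of the multivectors supported on
  the subsets of \<open>{1..p + q}\<close>. The product below depends only on \<open>p\<close>, which fixes the squares of
  the generators.
\<close>

type_synonym multivector = "nat set \<Rightarrow>\<^sub>0 real"

abbreviation cl_coeff :: "multivector \<Rightarrow> nat set \<Rightarrow> real" where
  "cl_coeff \<equiv> Poly_Mapping.lookup"

definition clifford :: "nat \<Rightarrow> nat \<Rightarrow> multivector set" where
  "clifford p q = {u. Poly_Mapping.keys u \<subseteq> Pow {1..p + q}}"

definition cl_eps :: "nat \<Rightarrow> nat \<Rightarrow> real" where
  "cl_eps p i = (if i \<le> p then 1 else - 1)"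

text \<open>
  Sorting the product of the basis elements indexed by \<open>A\<close> and \<open>B\<close> costs a factor \<open>-1\<close> for each
  pair \<open>a \<in> A\<close>, \<open>b \<in> B\<close> with \<open>b < a\<close>, and each index common to \<open>A\<close> and \<open>B\<close> is
  cancelled at the cost of the square of its generator.
\<close>

definition cl_sign :: "nat \<Rightarrow> nat set \<Rightarrow> nat set \<Rightarrow> real" where
  "cl_sign p A B =
    (\<Prod>a\<in>A. \<Prod>b\<in>B. if b < a then - 1 else if b = a then cl_eps p a else 1)"

definition cl_mult :: "nat \<Rightarrow> multivector \<Rightarrow> multivector \<Rightarrow> multivector" where
  "cl_mult p u v =
    (\<Sum>A\<in>Poly_Mapping.keys u. \<Sum>B\<in>Poly_Mapping.keys v.
       Poly_Mapping.single (sym_diff A B) (cl_sign p A B * cl_coeff u A * cl_coeff v B))"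

definition cl_real :: "real \<Rightarrow> multivector" where
  "cl_real c = Poly_Mapping.single {} c"

definition cl_gen :: "nat \<Rightarrow> multivector" where
  "cl_gen i = Poly_Mapping.single {i} 1"

definition cl_blade :: "nat \<Rightarrow> nat set \<Rightarrow> multivector" where
  "cl_blade p S = foldr (cl_mult p) (map cl_gen (sorted_list_of_set S)) (cl_real 1)"


subsection \<open>Adequacy of the model\<close>

text \<open>
  The multivectors of signature \<open>(p, q)\<close> form an associative unital real algebra whose
  generators satisfy the Clifford relations and in which the ordered products of generators form
  a basis.
\<close>

lemma cl_mult_superset:
  assumes "finite K" "Poly_Mapping.keys u \<subseteq> K" "finite L" "Poly_Mapping.keys v \<subseteq> L"
  shows "cl_mult p u v =
    (\<Sum>A\<in>K. \<Sum>B\<in>L.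
       Poly_Mapping.single (sym_diff A B) (cl_sign p A B * cl_coeff u A * cl_coeff v B))"
proof -
  have "cl_mult p u v =
    (\<Sum>A\<in>Poly_Mapping.keys u. \<Sum>B\<in>L.
       Poly_Mapping.single (sym_diff A B) (cl_sign p A B * cl_coeff u A * cl_coeff v B))"
    unfolding cl_mult_def
    by (intro sum.cong refl sum.mono_neutral_left) (use assms in \<open>auto simp: in_keys_iff\<close>)
  also have "\<dots> = (\<Sum>A\<in>K. \<Sum>B\<in>L.
       Poly_Mapping.single (sym_diff A B) (cl_sign p A B * cl_coeff u A * cl_coeff v B))"
    by (intro sum.mono_neutral_left) (use assms in \<open>auto simp: in_keys_iff\<close>)
  finally show ?thesis .
qed

lemma cl_mult_add_left: "cl_mult p (u + v) w = cl_mult p u w + cl_mult p v w"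
proof -
  let ?K = "Poly_Mapping.keys u \<union> Poly_Mapping.keys v" and ?L = "Poly_Mapping.keys w"
  have "Poly_Mapping.keys (u + v) \<subseteq> ?K" by (rule Poly_Mapping.keys_add)
  then show ?thesis
    using cl_mult_superset[of ?K "u + v" ?L w p] cl_mult_superset[of ?K u ?L w p]
      cl_mult_superset[of ?K v ?L w p]
    by (simp add: lookup_add algebra_simps single_add flip: sum.distrib)
qed

lemma cl_mult_add_right: "cl_mult p u (v + w) = cl_mult p u v + cl_mult p u w"
proof -
  let ?K = "Poly_Mapping.keys u" and ?L = "Poly_Mapping.keys v \<union> Poly_Mapping.keys w"
  have "Poly_Mapping.keys (v + w) \<subseteq> ?L" by (rule Poly_Mapping.keys_add)
  then show ?thesis
    using cl_mult_superset[of ?K u ?L "v + w" p] cl_mult_superset[of ?K u ?L v p]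
      cl_mult_superset[of ?K u ?L w p]
    by (simp add: lookup_add algebra_simps single_add flip: sum.distrib)
qed

lemma cl_mult_zero [simp]: "cl_mult p 0 u = 0" "cl_mult p u 0 = 0"
  by (simp_all add: cl_mult_def)

lemma cl_mult_sum_left: "cl_mult p (\<Sum>i\<in>I. f i) v = (\<Sum>i\<in>I. cl_mult p (f i) v)"
  by (induction I rule: infinite_finite_induct) (simp_all add: cl_mult_add_left)

lemma cl_mult_sum_right: "cl_mult p v (\<Sum>i\<in>I. f i) = (\<Sum>i\<in>I. cl_mult p v (f i))"
  by (induction I rule: infinite_finite_induct) (simp_all add: cl_mult_add_right)

lemma cl_mult_single:
  "cl_mult p (Poly_Mapping.single A a) (Poly_Mapping.single B b) =
    Poly_Mapping.single (sym_diff A B) (cl_sign p A B * a * b)"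
  using cl_mult_superset[of "{A}" "Poly_Mapping.single A a" "{B}" "Poly_Mapping.single B b" p]
  by simp

lemma multivector_expand:
  "u = (\<Sum>A\<in>Poly_Mapping.keys u. Poly_Mapping.single A (cl_coeff u A))" for u :: multivector
  by (rule poly_mapping_eqI)
     (auto simp: lookup_sum lookup_single when_def in_keys_iff sum.delta)

lemma prod_sym_diff:
  fixes h :: "'a \<Rightarrow> real"
  assumes "finite A" "finite B" "\<And>x. h x * h x = 1"
  shows "prod h (sym_diff A B) = prod h A * prod h B"
proof -
  have "prod h A * prod h B =
      (prod h (A - B) * prod h (A \<inter> B)) * (prod h (B - A) * prod h (A \<inter> B))"
    using prod.Int_Diff[OF assms(1), of h B] prod.Int_Diff[OF assms(2), of h A]
    by (simp add: Int_commute mult.commute)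
  also have "\<dots> = prod h (A - B) * prod h (B - A) * (prod h (A \<inter> B) * prod h (A \<inter> B))"
    by (simp add: algebra_simps)
  also have "prod h (A \<inter> B) * prod h (A \<inter> B) = 1"
    by (simp add: assms(3) flip: prod.distrib)
  also have "prod h (A - B) * prod h (B - A) = prod h (sym_diff A B)"
    using assms(1,2) by (subst prod.union_disjoint) auto
  finally show ?thesis by simp
qed

lemma cl_sign_sym_diff_left:
  assumes "finite A" "finite B"
  shows "cl_sign p (sym_diff A B) C = cl_sign p A C * cl_sign p B C"
  unfolding cl_sign_def
  by (rule prod_sym_diff[OF assms]) (auto simp: cl_eps_def simp flip: prod.distrib intro!: prod.neutral)

lemma cl_sign_sym_diff_right:
  assumes "finite B" "finite C"
  shows "cl_sign p A (sym_diff B C) = cl_sign p A B * cl_sign p A C"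
  unfolding cl_sign_def prod.distrib[symmetric]
  by (intro prod.cong refl prod_sym_diff[OF assms]) (auto simp: cl_eps_def)

lemma finite_keys_clifford: "u \<in> clifford p q \<Longrightarrow> A \<in> Poly_Mapping.keys u \<Longrightarrow> finite A"
  by (auto simp: clifford_def intro: finite_subset)

theorem cl_mult_assoc:
  assumes "u \<in> clifford p q" "v \<in> clifford p q" "w \<in> clifford p q"
  shows "cl_mult p (cl_mult p u v) w = cl_mult p u (cl_mult p v w)"
proof -
  let ?s = "Poly_Mapping.single :: nat set \<Rightarrow> real \<Rightarrow> multivector"
  have *: "cl_mult p (cl_mult p (?s A a) (?s B b)) (?s C c)
         = cl_mult p (?s A a) (cl_mult p (?s B b) (?s C c))"
    if "finite A" "finite B" "finite C" for A B C a b c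
  proof -
    have "sym_diff (sym_diff A B) C = sym_diff A (sym_diff B C)" by blast
    then show ?thesis
      using that
      by (simp add: cl_mult_single cl_sign_sym_diff_left cl_sign_sym_diff_right mult_ac)
  qed
  have "cl_mult p (cl_mult p (\<Sum>A\<in>Poly_Mapping.keys u. ?s A (cl_coeff u A))
            (\<Sum>B\<in>Poly_Mapping.keys v. ?s B (cl_coeff v B)))
          (\<Sum>C\<in>Poly_Mapping.keys w. ?s C (cl_coeff w C))
      = cl_mult p (\<Sum>A\<in>Poly_Mapping.keys u. ?s A (cl_coeff u A))
          (cl_mult p (\<Sum>B\<in>Poly_Mapping.keys v. ?s B (cl_coeff v B))
            (\<Sum>C\<in>Poly_Mapping.keys w. ?s C (cl_coeff w C)))"
    unfolding cl_mult_sum_left cl_mult_sum_right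
    by (intro sum.cong refl *) (use assms finite_keys_clifford in blast)+
  then show ?thesis by (simp flip: multivector_expand)
qed

lemma cl_mult_one [simp]: "cl_mult p (cl_real 1) u = u" "cl_mult p u (cl_real 1) = u"
proof -
  have 1: "Poly_Mapping.keys (cl_real 1) = {{}}" by (simp add: cl_real_def)
  show "cl_mult p (cl_real 1) u = u"
    unfolding cl_mult_def 1 by (simp add: cl_real_def cl_sign_def flip: multivector_expand)
  show "cl_mult p u (cl_real 1) = u"
    unfolding cl_mult_def 1 by (simp add: cl_real_def cl_sign_def flip: multivector_expand)
qed

lemma lookup_cl_mult_real: "cl_coeff (cl_mult p u (cl_real c)) S = cl_coeff u S * c"
proof -
  have "cl_mult p u (cl_real c) =
      (\<Sum>A\<in>Poly_Mapping.keys u. Poly_Mapping.single A (cl_coeff u A * c))"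
    using cl_mult_superset[of "Poly_Mapping.keys u" u "{{}}" "cl_real c" p]
    by (simp add: cl_real_def cl_sign_def)
  then show ?thesis
    by (auto simp: lookup_sum lookup_single when_def in_keys_iff sum.delta)
qed

lemma cl_mult_real_commute: "cl_mult p (cl_real c) u = cl_mult p u (cl_real c)"
  using cl_mult_superset[of "{{}}" "cl_real c" "Poly_Mapping.keys u" u p]
    cl_mult_superset[of "Poly_Mapping.keys u" u "{{}}" "cl_real c" p]
  by (simp add: cl_real_def cl_sign_def mult_ac)

lemma cl_real_in_clifford: "cl_real c \<in> clifford p q"
  by (simp add: clifford_def cl_real_def)

lemma cl_gen_in_clifford: "i \<in> {1..p + q} \<Longrightarrow> cl_gen i \<in> clifford p q"
  by (simp add: clifford_def cl_gen_def)

lemma cl_add_in_clifford: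
  "u \<in> clifford p q \<Longrightarrow> v \<in> clifford p q \<Longrightarrow> u + v \<in> clifford p q"
  using Poly_Mapping.keys_add[of u v] by (auto simp: clifford_def)

lemma cl_sum_in_clifford:
  "(\<And>i. i \<in> I \<Longrightarrow> f i \<in> clifford p q) \<Longrightarrow> (\<Sum>i\<in>I. f i) \<in> clifford p q"
proof (induction I rule: infinite_finite_induct)
  case (insert i I)
  then show ?case by (simp add: cl_add_in_clifford)
qed (simp_all add: clifford_def)

lemma cl_mult_in_clifford:
  assumes "u \<in> clifford p q" "v \<in> clifford p q"
  shows "cl_mult p u v \<in> clifford p q"
  unfolding cl_mult_def
proof (intro cl_sum_in_clifford)
  fix A B assume "A \<in> Poly_Mapping.keys u" "B \<in> Poly_Mapping.keys v"
  then have "sym_diff A B \<subseteq> {1..p + q}" using assms by (auto simp: clifford_def)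
  then show "Poly_Mapping.single (sym_diff A B) (cl_sign p A B * cl_coeff u A * cl_coeff v B)
      \<in> clifford p q"
    by (simp add: clifford_def)
qed

theorem cl_gen_relation:
  "cl_mult p (cl_gen l) (cl_gen k) + cl_mult p (cl_gen k) (cl_gen l) =
    cl_real (if l = k then 2 * cl_eps p l else 0)"
proof (cases "l = k")
  case True
  then show ?thesis
    by (simp add: cl_gen_def cl_mult_single cl_real_def cl_sign_def flip: single_add)
next
  case False
  then have "sym_diff {l} {k} = {l, k}" "sym_diff {k} {l} = {l, k}" by auto
  with False show ?thesis
    by (simp add: cl_gen_def cl_mult_single cl_real_def cl_sign_def flip: single_add)
qed

theorem cl_blade_eq: "finite S \<Longrightarrow> cl_blade p S = Poly_Mapping.single S 1"
proof -
  have *: "foldr (cl_mult p) (map cl_gen xs) (cl_real 1) = Poly_Mapping.single (set xs) 1"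
    if "sorted xs" "distinct xs" for xs
    using that
  proof (induction xs)
    case (Cons a xs)
    then have less: "\<forall>x\<in>set xs. a < x" by (auto simp: less_le)
    then have "sym_diff {a} (set xs) = insert a (set xs)" by auto
    moreover have "cl_sign p {a} (set xs) = 1"
      using less by (auto simp: cl_sign_def intro!: prod.neutral)
    ultimately show ?case
      using Cons by (simp add: cl_gen_def cl_mult_single)
  qed (simp add: cl_real_def)
  assume "finite S"
  then show ?thesis using *[of "sorted_list_of_set S"] by (simp add: cl_blade_def)
qed

theorem cl_blade_expansion:
  assumes "u \<in> clifford p q"
  shows "u = (\<Sum>S\<in>Pow {1..p + q}. cl_mult p (cl_blade p S) (cl_real (c S)))
    \<longleftrightarrow> (\<forall>S\<in>Pow {1..p + q}. c S = cl_coeff u S)"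
proof -
  let ?r = "\<Sum>S\<in>Pow {1..p + q}. cl_mult p (cl_blade p S) (cl_real (c S))"
  have lk: "cl_coeff ?r T = (if T \<in> Pow {1..p + q} then c T else 0)" for T
  proof -
    have "cl_coeff ?r T = (\<Sum>S\<in>Pow {1..p + q}. if T = S then c S else 0)"
      unfolding lookup_sum
    proof (intro sum.cong refl)
      fix S assume "S \<in> Pow {1..p + q}"
      then have "finite S" by (auto intro: finite_subset)
      then show "cl_coeff (cl_mult p (cl_blade p S) (cl_real (c S))) T = (if T = S then c S else 0)"
        by (simp add: lookup_cl_mult_real cl_blade_eq lookup_single when_def)
    qed
    then show ?thesis by simp
  qed
  have out: "cl_coeff u T = 0" if "T \<notin> Pow {1..p + q}" for T
    using assms that by (auto simp: clifford_def in_keys_iff)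
  show ?thesis
    unfolding poly_mapping_eq_iff fun_eq_iff lk using out by force
qed


section \<open>Fourier transform and convolution\<close>

definition cl_exp :: "nat \<Rightarrow> multivector \<Rightarrow> real \<Rightarrow> multivector" where
  "cl_exp p \<mu> \<theta> = cl_real (cos \<theta>) + cl_mult p \<mu> (cl_real (sin \<theta>))"

definition cl_L1 :: "nat \<Rightarrow> nat \<Rightarrow> (real \<Rightarrow> multivector) set" where
  "cl_L1 p q = {f. (\<forall>x. f x \<in> clifford p q) \<and>
    (\<forall>S\<in>Pow {1..p + q}. integrable lebesgue (\<lambda>x. cl_coeff (f x) S))}"

definition cl_integral :: "nat \<Rightarrow> nat \<Rightarrow> (real \<Rightarrow> multivector) \<Rightarrow> multivector" where
  "cl_integral p q f =
    (\<Sum>S\<in>Pow {1..p + q}. Poly_Mapping.single S (\<integral>x. cl_coeff (f x) S \<partial>lebesgue))"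

definition cl_fourier ::
    "nat \<Rightarrow> nat \<Rightarrow> multivector \<Rightarrow> (real \<Rightarrow> multivector) \<Rightarrow> real \<Rightarrow> multivector" where
  "cl_fourier p q \<mu> f \<xi> = cl_integral p q (\<lambda>x. cl_mult p (f x) (cl_exp p \<mu> (x * \<xi>)))"

text \<open>
  The convolution integral exists for almost every \<open>y\<close>. At the exceptional points a coefficient
  whose integral does not exist takes the value 0; these points form a null set and do not affect
  the Fourier transform.
\<close>

definition cl_convolution ::
    "nat \<Rightarrow> nat \<Rightarrow> (real \<Rightarrow> multivector) \<Rightarrow> (real \<Rightarrow> multivector) \<Rightarrow> real \<Rightarrow> multivector" where
  "cl_convolution p q f g y = cl_integral p q (\<lambda>x. cl_mult p (f x) (g (y - x)))"

end

theory Submission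
  imports Defs
begin

text \<open>
  Let \<open>C f\<close> and \<open>S f\<close> be the cosine and sine transforms of \<open>f\<close>, so that the Fourier transform is
  \<open>C f + S f \<mu>\<close>. Their kernels are real and hence central. Fubini's theorem, applied
  coefficientwise, and the addition formulas give \<open>C (f * g) = C f C g - S f S g\<close> and
  \<open>S (f * g) = S f C g + C f S g\<close>. In the sum over \<open>\<Sigma>\<close>, the factor from \<open>g\<^sub>\<Sigma>\<close> lies in the
  commutative subalgebra generated by \<open>\<mu>\<close>, so \<open>\<mu>\<^sup>2 = -1\<close> can be used to multiply it out; summing
  \<open>e\<^sub>\<Sigma> C g\<^sub>\<Sigma>\<close> and \<open>e\<^sub>\<Sigma> S g\<^sub>\<Sigma>\<close> over \<open>\<Sigma>\<close> recovers \<open>C g\<close> and \<open>S g\<close>.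
\<close>

section \<open>Almost-everywhere equality on complete measure spaces\<close>

text \<open>The preimages of a Borel set under \<open>f\<close> and \<open>g\<close> differ only
  within a null set, and completeness keeps a measurable set measurable under such a change.\<close>

lemma (in complete_measure) borel_measurable_cong_AE:
  assumes "f \<in> borel_measurable M" "AE x in M. f x = g x"
  shows "g \<in> borel_measurable M"
proof (rule measurableI)
  fix A :: "'b set" assume A: "A \<in> sets borel"
  show "g -` A \<inter> space M \<in> sets M"
  proof (rule in_sets_AE)
    show "AE x in M. x \<in> f -` A \<inter> space M \<longleftrightarrow> x \<in> g -` A \<inter> space M"
      using assms(2) by eventually_elim auto
  qed (use assms(1) A in \<open>auto intro: measurable_sets\<close>)
qed simp

lemma (in complete_measure) integrable_cong_AE_iff:
  fixes f g :: "'a \<Rightarrow> 'b::{banach, second_countable_topology}"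
  assumes "AE x in M. f x = g x"
  shows "integrable M f \<longleftrightarrow> integrable M g"
proof -
  have "AE x in M. g x = f x" using assms by eventually_elim simp
  then show ?thesis
    using assms borel_measurable_cong_AE[of f g] borel_measurable_cong_AE[of g f]
      integrable_cong_AE[of f M g] borel_measurable_integrable by blast
qed

lemma (in complete_measure) integral_eq_AE:
  fixes f g :: "'a \<Rightarrow> 'b::{banach, second_countable_topology}"
  assumes "AE x in M. f x = g x"
  shows "integral\<^sup>L M f = integral\<^sup>L M g"
proof (cases "integrable M f")
  case True
  then show ?thesis
    using assms integrable_cong_AE_iff[OF assms] by (intro integral_cong_AE) auto
next
  \<comment> \<open>Neither function is integrable, so both integrals have the default value
    0.\<close>
  case False
  then show ?thesis
    using integrable_cong_AE_iff[OF assms] by (simp add: not_integrable_integral_eq)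
qed

section \<open>Borel representatives and reflection of null sets\<close>

text \<open>Fubini's theorem is applied on the product of two copies of \<open>lborel\<close>, where
  measurability is Borel measurability; a Borel representative carries a Lebesgue integrable
  function there.\<close>

lemma integrable_lebesgue_obtain_borel:
  fixes f :: "'a::euclidean_space \<Rightarrow> real"
  assumes "integrable lebesgue f"
  obtains f' where "integrable lborel f'" "AE x in lborel. f x = f' x"
proof -
  obtain f' where f': "f' \<in> borel_measurable lborel" "AE x in lborel. f x = f' x"
    using completion_ex_borel_measurable_real[OF borel_measurable_integrable[OF assms]] by blast
  have "integrable lebesgue f'"
    using completion.integrable_cong_AE_iff[OF AE_completion[OF f'(2)]] assms by simp
  then have "integrable lborel f'"
    using f'(1) by (simp add: integrable_completion)
  with f'(2) show ?thesis using that by blast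
qed

text \<open>An affine bijection preserves null sets. As \<open>P\<close> may be non-measurable, its
  exceptional points are first enclosed in a measurable null set \<open>N\<close>.\<close>

lemma AE_lborel_reflect:
  fixes P :: "real \<Rightarrow> bool"
  assumes "AE x in lborel. P x"
  shows "AE x in lborel. P (y - x)"
proof -
  obtain N where N: "{x \<in> space lborel. \<not> P x} \<subseteq> N" "N \<in> null_sets lborel"
    using AE_E[OF assms] by (metis null_setsI)
  have "AE x in lborel. y + (-1) * x \<notin> N"
  proof (rule AE_borel_affine)
    show "Measurable.pred borel (\<lambda>x. x \<notin> N)"
      using N(2) by (auto simp: null_sets_def)
  qed (use N(2) AE_not_in in auto)
  then show ?thesis
    by eventually_elim (use N(1) in auto)
qed

section \<open>Convolution of real integrable functions\<close>

text \<open>By translation invariance, integrating the absolute value over \<open>y\<close> gives |a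
  x| times the L1 norm of \<open>b\<close>, so the iterated absolute integral is finite.\<close>

lemma integrable_convolution_kernel:
  fixes a b :: "real \<Rightarrow> real"
  assumes "integrable lborel a" "integrable lborel b"
  shows "integrable (lborel \<Otimes>\<^sub>M lborel) (\<lambda>(x, y). a x * b (y - x))"
proof (rule lborel_pair.Fubini_integrable)
  have [measurable]: "a \<in> borel_measurable borel" "b \<in> borel_measurable borel"
    using assms by (auto dest: borel_measurable_integrable)
  show "(\<lambda>(x, y). a x * b (y - x)) \<in> borel_measurable (lborel \<Otimes>\<^sub>M lborel)" by measurable
  have "(\<integral>y. norm (case (x, y) of (x, y) \<Rightarrow> a x * b (y - x)) \<partial>lborel) =
      norm (a x) * (\<integral>t. norm (b t) \<partial>lborel)" for x
    using lborel_integral_real_affine[of 1 "\<lambda>t. norm (b t)" "- x"]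
    by (simp add: abs_mult)
  then show "integrable lborel
      (\<lambda>x. \<integral>y. norm (case (x, y) of (x, y) \<Rightarrow> a x * b (y - x)) \<partial>lborel)"
    using assms(1) by simp
  show "AE x in lborel. integrable lborel (\<lambda>y. case (x, y) of (x, y) \<Rightarrow> a x * b (y - x))"
  proof (rule AE_I2)
    fix x
    show "integrable lborel (\<lambda>y. case (x, y) of (x, y) \<Rightarrow> a x * b (y - x))"
      using lborel_integrable_real_affine[OF assms(2), of 1 "- x"] by simp
  qed
qed

text \<open>For Borel representatives the first two claims are Fubini for the convolution kernel.
  For the third, the order of integration is exchanged and y = x + t is substituted.\<close>

lemma convolution_lebesgue:
  fixes a b :: "real \<Rightarrow> real"
  assumes "integrable lebesgue a" "integrable lebesgue b"
  shows AE_integrable_convolution: "AE y in lebesgue. integrable lebesgue (\<lambda>x. a x * b (y - x))"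
    and integrable_convolution: "integrable lebesgue (\<lambda>y. \<integral>x. a x * b (y - x) \<partial>lebesgue)"
    and integral_convolution_weighted: "\<And>h :: real \<Rightarrow> real.
      h \<in> borel_measurable borel \<Longrightarrow> (\<And>y. \<bar>h y\<bar> \<le> B) \<Longrightarrow>
      (\<integral>y. (\<integral>x. a x * b (y - x) \<partial>lebesgue) * h y \<partial>lebesgue) =
      (\<integral>x. a x * (\<integral>t. b t * h (x + t) \<partial>lebesgue) \<partial>lebesgue)"
proof -
  obtain a' where a': "integrable lborel a'" "AE x in lborel. a x = a' x"
    using integrable_lebesgue_obtain_borel[OF assms(1)] .
  obtain b' where b': "integrable lborel b'" "AE x in lborel. b x = b' x"
    using integrable_lebesgue_obtain_borel[OF assms(2)] .
  have [measurable]: "a' \<in> borel_measurable borel" "b' \<in> borel_measurable borel"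
    using a'(1) b'(1) by (auto dest: borel_measurable_integrable)
  \<comment> \<open>For each fixed \<open>y\<close> the reflected exceptional set of
    \<open>b\<close> is again null, so the inner integrals agree for every \<open>y\<close>, not
    just almost every one.\<close>
  have ab: "AE x in lebesgue. a x * b (y - x) = a' x * b' (y - x)" for y
  proof (rule AE_completion)
    show "AE x in lborel. a x * b (y - x) = a' x * b' (y - x)"
      using a'(2) AE_lborel_reflect[OF b'(2), of y] by eventually_elim simp
  qed
  note kernel = integrable_convolution_kernel[OF a'(1) b'(1)]
  have inner: "(\<integral>x. a x * b (y - x) \<partial>lebesgue) = (\<integral>x. a' x * b' (y - x) \<partial>lborel)" for y
    by (simp add: completion.integral_eq_AE[OF ab] integral_completion)
  show "AE y in lebesgue. integrable lebesgue (\<lambda>x. a x * b (y - x))"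
    using AE_completion[OF lborel_pair.AE_integrable_snd[OF kernel]]
    by (simp add: completion.integrable_cong_AE_iff[OF ab] integrable_completion)
  have "integrable lborel (\<lambda>y. \<integral>x. a' x * b' (y - x) \<partial>lborel)"
    by (rule lborel_pair.integrable_snd[OF kernel])
  then show "integrable lebesgue (\<lambda>y. \<integral>x. a x * b (y - x) \<partial>lebesgue)"
    unfolding inner by (subst integrable_completion) auto
  fix h :: "real \<Rightarrow> real"
  assume h [measurable]: "h \<in> borel_measurable borel" and B: "\<And>y. \<bar>h y\<bar> \<le> B"
  \<comment> \<open>The bound on \<open>h\<close> dominates the weighted kernel by a multiple of the
    integrable kernel, which permits Fubini.\<close>
  have "integrable (lborel \<Otimes>\<^sub>M lborel) (\<lambda>(x, y). a' x * b' (y - x) * h y)"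
  proof (rule Bochner_Integration.integrable_bound)
    show "integrable (lborel \<Otimes>\<^sub>M lborel) (\<lambda>z. B * (case z of (x, y) \<Rightarrow> a' x * b' (y - x)))"
      using kernel by simp
    show "AE z in lborel \<Otimes>\<^sub>M lborel. norm (case z of (x, y) \<Rightarrow> a' x * b' (y - x) * h y) \<le>
        norm (B * (case z of (x, y) \<Rightarrow> a' x * b' (y - x)))"
      by (intro AE_I2) (auto simp: abs_mult mult.commute[of _ "\<bar>h _\<bar>"]
        intro!: mult_right_mono order_trans[OF B abs_ge_self])
  qed measurable
  note Fubini = lborel_pair.Fubini_integral[OF this]
  have shift: "(\<integral>y. b' (y - x) * h y \<partial>lborel) = (\<integral>t. b' t * h (x + t) \<partial>lborel)" for x
    using lborel_integral_real_affine[of 1 "\<lambda>y. b' (y - x) * h y" x] by simp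
  have "(\<integral>y. (\<integral>x. a x * b (y - x) \<partial>lebesgue) * h y \<partial>lebesgue) =
      (\<integral>y. (\<integral>x. a' x * b' (y - x) * h y \<partial>lborel) \<partial>lborel)"
    unfolding inner by (subst integral_completion) auto
  also have "\<dots> = (\<integral>x. a' x * (\<integral>t. b' t * h (x + t) \<partial>lborel) \<partial>lborel)"
    by (subst Fubini) (simp add: mult.assoc shift)
  also have "\<dots> = (\<integral>x. a' x * (\<integral>t. b' t * h (x + t) \<partial>lebesgue) \<partial>lebesgue)"
    by (simp add: integral_completion)
  also have "\<dots> = (\<integral>x. a' x * (\<integral>t. b t * h (x + t) \<partial>lebesgue) \<partial>lebesgue)"
  proof -
    have "(\<integral>t. b' t * h (x + t) \<partial>lebesgue) = (\<integral>t. b t * h (x + t) \<partial>lebesgue)" for x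
      by (rule completion.integral_eq_AE) (use AE_completion[OF b'(2)] in eventually_elim, simp)
    then show ?thesis by simp
  qed
  also have "\<dots> = (\<integral>x. a x * (\<integral>t. b t * h (x + t) \<partial>lebesgue) \<partial>lebesgue)"
    by (rule completion.integral_eq_AE) (use AE_completion[OF a'(2)] in eventually_elim, simp)
  finally show "(\<integral>y. (\<integral>x. a x * b (y - x) \<partial>lebesgue) * h y \<partial>lebesgue) =
      (\<integral>x. a x * (\<integral>t. b t * h (x + t) \<partial>lebesgue) \<partial>lebesgue)" .
qed


section \<open>Clifford-valued integration, coefficient by coefficient\<close>

lemma integral_double_sum:
  fixes F :: "'i \<Rightarrow> 'j \<Rightarrow> 'a \<Rightarrow> real"
  assumes "\<And>i j. i \<in> I \<Longrightarrow> j \<in> J \<Longrightarrow> integrable M (F i j)"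
  shows "(\<integral>x. (\<Sum>i\<in>I. \<Sum>j\<in>J. c i j * F i j x) \<partial>M) =
    (\<Sum>i\<in>I. \<Sum>j\<in>J. c i j * (\<integral>x. F i j x \<partial>M))"
  using assms by (simp add: Bochner_Integration.integral_sum)

lemma clifford_eqI:
  assumes "u \<in> clifford p q" "v \<in> clifford p q"
    and "\<And>T. T \<in> Pow {1..p + q} \<Longrightarrow> cl_coeff u T = cl_coeff v T"
  shows "u = v"
proof (rule poly_mapping_eqI)
  fix T
  have "cl_coeff w T = 0" if "w \<in> clifford p q" "T \<notin> Pow {1..p + q}" for w
    using that in_keys_iff[of T w] unfolding clifford_def by blast
  then show "cl_coeff u T = cl_coeff v T"
    using assms by metis
qed

lemma cl_mult_minus_left: "cl_mult p (- u) v = - cl_mult p u v"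
  using cl_mult_add_left[of p "- u" u v] by (simp add: eq_neg_iff_add_eq_0)

lemma cl_mult_minus_right: "cl_mult p u (- v) = - cl_mult p u v"
  using cl_mult_add_right[of p u "- v" v] by (simp add: eq_neg_iff_add_eq_0)

text \<open>Summing over all index sets instead of the supports makes the range independent of
  \<open>u\<close> and \<open>v\<close>. For function values, each coefficient is then a fixed
  bilinear form with constant structure coefficients, and integrals can pass through the
  sums.\<close>

lemma lookup_cl_mult:
  assumes "u \<in> clifford p q" "v \<in> clifford p q"
  shows "cl_coeff (cl_mult p u v) T =
    (\<Sum>A\<in>Pow {1..p + q}. \<Sum>B\<in>Pow {1..p + q}.
       (if sym_diff A B = T then cl_sign p A B else 0) * (cl_coeff u A * cl_coeff v B))"
proof -
  have "cl_mult p u v = (\<Sum>A\<in>Pow {1..p + q}. \<Sum>B\<in>Pow {1..p + q}.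
      Poly_Mapping.single (sym_diff A B) (cl_sign p A B * cl_coeff u A * cl_coeff v B))"
    using assms by (intro cl_mult_superset) (auto simp: clifford_def)
  then show ?thesis
    by (simp add: lookup_sum lookup_single when_def mult.assoc if_distrib[of "\<lambda>c. c * _"]
      cong: if_cong)
qed

lemma cl_blade_in_clifford: "S \<in> Pow {1..p + q} \<Longrightarrow> cl_blade p S \<in> clifford p q"
  by (auto simp: clifford_def cl_blade_eq finite_subset)

lemma cl_integral_in_clifford: "cl_integral p q f \<in> clifford p q"
  unfolding cl_integral_def by (rule cl_sum_in_clifford) (simp add: clifford_def)

lemma lookup_cl_integral:
  assumes "T \<in> Pow {1..p + q}"
  shows "cl_coeff (cl_integral p q f) T = (\<integral>x. cl_coeff (f x) T \<partial>lebesgue)"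
  using assms by (simp add: cl_integral_def lookup_sum lookup_single when_def)

lemma cl_integral_add:
  assumes "f \<in> cl_L1 p q" "g \<in> cl_L1 p q"
  shows "cl_integral p q (\<lambda>x. f x + g x) = cl_integral p q f + cl_integral p q g"
  by (rule clifford_eqI[of _ p q])
     (use assms in \<open>auto simp: cl_integral_in_clifford cl_add_in_clifford lookup_cl_integral
       lookup_add cl_L1_def simp del: One_nat_def\<close>)

lemma cl_mult_const_in_L1:
  assumes "f \<in> cl_L1 p q" "c \<in> clifford p q"
  shows "(\<lambda>x. cl_mult p (f x) c) \<in> cl_L1 p q"
proof -
  have f: "f x \<in> clifford p q" for x using assms(1) by (simp add: cl_L1_def)
  show ?thesis
    using assms by (auto simp: cl_L1_def cl_mult_in_clifford lookup_cl_mult[OF f assms(2)])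
qed

text \<open>Each coefficient of the product is a finite linear combination of coefficients of
  \<open>f x\<close> with constants determined by \<open>c\<close>, so linearity of the real
  integral applies.\<close>

lemma cl_integral_mult_const:
  assumes "f \<in> cl_L1 p q" "c \<in> clifford p q"
  shows "cl_integral p q (\<lambda>x. cl_mult p (f x) c) = cl_mult p (cl_integral p q f) c"
proof (rule clifford_eqI)
  fix T assume T: "T \<in> Pow {1..p + q}"
  have f: "f x \<in> clifford p q" "A \<in> Pow {1..p + q} \<Longrightarrow> integrable lebesgue (\<lambda>x. cl_coeff (f x) A)"
    for x A using assms(1) by (auto simp: cl_L1_def)
  have "cl_coeff (cl_integral p q (\<lambda>x. cl_mult p (f x) c)) T =
      (\<integral>x. (\<Sum>A\<in>Pow {1..p + q}. \<Sum>B\<in>Pow {1..p + q}.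
        (if sym_diff A B = T then cl_sign p A B else 0) * (cl_coeff (f x) A * cl_coeff c B)) \<partial>lebesgue)"
    by (simp only: lookup_cl_integral[OF T] lookup_cl_mult[OF f(1) assms(2)])
  also have "\<dots> = (\<Sum>A\<in>Pow {1..p + q}. \<Sum>B\<in>Pow {1..p + q}.
        (if sym_diff A B = T then cl_sign p A B else 0) *
          ((\<integral>x. cl_coeff (f x) A \<partial>lebesgue) * cl_coeff c B))"
    using f(2) by (simp add: Bochner_Integration.integral_sum)
  also have "\<dots> = cl_coeff (cl_mult p (cl_integral p q f) c) T"
    by (simp add: lookup_cl_mult[OF cl_integral_in_clifford assms(2)] lookup_cl_integral)
  finally show "cl_coeff (cl_integral p q (\<lambda>x. cl_mult p (f x) c)) T =
      cl_coeff (cl_mult p (cl_integral p q f) c) T" .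
qed (use assms(2) in \<open>auto intro: cl_integral_in_clifford cl_mult_in_clifford\<close>)

section \<open>Moments against bounded real weights\<close>

text \<open>For the weights cos (x \<xi>) and sin (x \<xi>) these are the cosine and sine
  transforms. A general weight lets one convolution formula serve both.\<close>

definition cl_moment :: "nat \<Rightarrow> nat \<Rightarrow> (real \<Rightarrow> real) \<Rightarrow> (real \<Rightarrow> multivector) \<Rightarrow> multivector" where
  "cl_moment p q h f = cl_integral p q (\<lambda>x. cl_mult p (f x) (cl_real (h x)))"

text \<open>Borel measurability lets a weight enter the double integral over \<open>lborel\<close>;
  boundedness preserves integrability.\<close>

definition bounded_borel :: "(real \<Rightarrow> real) set" where
  "bounded_borel = {h \<in> borel_measurable borel. \<exists>B. \<forall>x. \<bar>h x\<bar> \<le> B}"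

lemma bounded_borel_trig:
  "(\<lambda>x. cos (x * \<xi>)) \<in> bounded_borel" "(\<lambda>x. sin (x * \<xi>)) \<in> bounded_borel"
  "(\<lambda>x. - sin (x * \<xi>)) \<in> bounded_borel"
  by (auto simp: bounded_borel_def intro!: exI[of _ 1])

lemma integrable_mult_bounded_borel:
  assumes "integrable lebesgue f" "h \<in> bounded_borel"
  shows "integrable lebesgue (\<lambda>x. f x * h x)"
proof -
  obtain B where B: "\<And>x. \<bar>h x\<bar> \<le> B" and h: "h \<in> borel_measurable borel"
    using assms(2) by (auto simp: bounded_borel_def)
  have [measurable]: "h \<in> borel_measurable lebesgue" "f \<in> borel_measurable lebesgue"
    using h assms(1) by (auto simp: measurable_completion)
  show ?thesis
  proof (rule Bochner_Integration.integrable_bound)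
    show "integrable lebesgue (\<lambda>x. B * f x)" using assms(1) by simp
    show "AE x in lebesgue. norm (f x * h x) \<le> norm (B * f x)"
      by (intro AE_I2) (auto simp: abs_mult mult.commute[of "\<bar>f _\<bar>"] intro!: mult_right_mono
        order_trans[OF B abs_ge_self])
  qed measurable
qed

lemma cl_moment_in_clifford: "cl_moment p q h f \<in> clifford p q"
  by (simp add: cl_moment_def cl_integral_in_clifford)

lemma lookup_cl_moment:
  "T \<in> Pow {1..p + q} \<Longrightarrow>
    cl_coeff (cl_moment p q h f) T = (\<integral>x. cl_coeff (f x) T * h x \<partial>lebesgue)"
  by (simp add: cl_moment_def lookup_cl_integral lookup_cl_mult_real)

lemma cl_mult_bounded_in_L1:
  assumes "f \<in> cl_L1 p q" "h \<in> bounded_borel"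
  shows "(\<lambda>x. cl_mult p (f x) (cl_real (h x))) \<in> cl_L1 p q"
  using assms by (auto simp: cl_L1_def cl_mult_in_clifford cl_real_in_clifford lookup_cl_mult_real
    intro: integrable_mult_bounded_borel)

lemma cl_real_coeff_in_L1:
  assumes "g \<in> cl_L1 p q" "S \<in> Pow {1..p + q}"
  shows "(\<lambda>x. cl_real (cl_coeff (g x) S)) \<in> cl_L1 p q"
proof -
  have "integrable lebesgue (\<lambda>x. cl_coeff (cl_real (cl_coeff (g x) S)) T)" for T
    using assms by (cases "T = {}") (auto simp: cl_L1_def cl_real_def lookup_single when_def)
  then show ?thesis by (simp add: cl_L1_def cl_real_in_clifford)
qed

text \<open>Real scalars are central, so \<open>c\<close> moves past \<open>v\<close> although
  \<open>u\<close> and \<open>v\<close> may fail to commute.\<close>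

lemma cl_mult_real_swap:
  assumes "u \<in> clifford p q" "v \<in> clifford p q"
  shows "cl_mult p (cl_mult p u v) (cl_real c) = cl_mult p (cl_mult p u (cl_real c)) v"
  using assms by (simp add: cl_mult_assoc[of _ p q] cl_real_in_clifford cl_mult_real_commute)

lemma cl_moment_mult_const:
  assumes "f \<in> cl_L1 p q" "c \<in> clifford p q" "h \<in> bounded_borel"
  shows "cl_moment p q h (\<lambda>x. cl_mult p (f x) c) = cl_mult p (cl_moment p q h f) c"
proof -
  have "f x \<in> clifford p q" for x using assms(1) by (simp add: cl_L1_def)
  then show ?thesis
    unfolding cl_moment_def
    by (simp add: cl_mult_real_swap[OF _ assms(2)]
      cl_integral_mult_const[OF cl_mult_bounded_in_L1[OF assms(1,3)] assms(2)])
qed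

text \<open>Both sides are supported on the empty index set, where the coefficient is the integral
  of the \<open>S\<close>-component of \<open>g\<close> times \<open>h\<close>.\<close>

lemma cl_moment_real:
  assumes "S \<in> Pow {1..p + q}"
  shows "cl_moment p q h (\<lambda>x. cl_real (cl_coeff (g x) S)) =
    cl_real (cl_coeff (cl_moment p q h g) S)"
proof (rule clifford_eqI[OF cl_moment_in_clifford cl_real_in_clifford])
  fix T assume "T \<in> Pow {1..p + q}"
  then show "cl_coeff (cl_moment p q h (\<lambda>x. cl_real (cl_coeff (g x) S))) T =
      cl_coeff (cl_real (cl_coeff (cl_moment p q h g) S)) T"
    using assms by (simp add: lookup_cl_moment cl_real_def lookup_single when_def)
qed

lemma cl_moment_minus: "cl_moment p q (\<lambda>x. - h x) f = - cl_moment p q h f"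
proof (rule clifford_eqI[OF cl_moment_in_clifford])
  show "- cl_moment p q h f \<in> clifford p q"
    using cl_moment_in_clifford[of p q h f] by (simp add: clifford_def)
qed (simp add: lookup_cl_moment)

text \<open>Moving the real sine in front of \<open>\<mu>\<close> leaves \<open>\<mu>\<close> as a
  constant right factor, which can be taken out of the integral.\<close>

lemma cl_fourier_moments:
  assumes "f \<in> cl_L1 p q" "\<mu> \<in> clifford p q"
  shows "cl_fourier p q \<mu> f \<xi> =
    cl_moment p q (\<lambda>x. cos (x * \<xi>)) f + cl_mult p (cl_moment p q (\<lambda>x. sin (x * \<xi>)) f) \<mu>"
proof -
  have "f x \<in> clifford p q" for x using assms(1) by (simp add: cl_L1_def)
  then have "cl_mult p (f x) (cl_exp p \<mu> (x * \<xi>)) =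
      cl_mult p (f x) (cl_real (cos (x * \<xi>))) +
      cl_mult p (cl_mult p (f x) (cl_real (sin (x * \<xi>)))) \<mu>" for x
    using assms(2) cl_mult_real_swap[of "f x" p q \<mu> "sin (x * \<xi>)"]
    by (simp add: cl_exp_def cl_mult_add_right cl_mult_assoc[of _ p q] cl_real_in_clifford)
  then show ?thesis
    using assms by (simp add: cl_fourier_def cl_moment_def cl_integral_add cl_integral_mult_const
      cl_mult_const_in_L1 cl_mult_bounded_in_L1 bounded_borel_trig)
qed

section \<open>Convolution of Clifford-valued functions\<close>

text \<open>The integral of the double sum is split where all scalar convolution integrals exist.
  There are finitely many pairs of index sets, so this holds off a null set; elsewhere default
  values may break the identity.\<close>

lemma AE_lookup_convolution:
  assumes "f \<in> cl_L1 p q" "g \<in> cl_L1 p q" "T \<in> Pow {1..p + q}"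
  shows "AE y in lebesgue. cl_coeff (cl_convolution p q f g y) T =
    (\<Sum>A\<in>Pow {1..p + q}. \<Sum>B\<in>Pow {1..p + q}.
       (if sym_diff A B = T then cl_sign p A B else 0) *
         (\<integral>x. cl_coeff (f x) A * cl_coeff (g (y - x)) B \<partial>lebesgue))"
proof -
  let ?P = "Pow {1..p + q}"
  have fg: "f x \<in> clifford p q" "g x \<in> clifford p q"
    "A \<in> ?P \<Longrightarrow> integrable lebesgue (\<lambda>x. cl_coeff (f x) A)"
    "A \<in> ?P \<Longrightarrow> integrable lebesgue (\<lambda>x. cl_coeff (g x) A)" for x A
    using assms by (auto simp: cl_L1_def)
  have "AE y in lebesgue. \<forall>A\<in>?P. \<forall>B\<in>?P.
      integrable lebesgue (\<lambda>x. cl_coeff (f x) A * cl_coeff (g (y - x)) B)"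
    using fg(3,4) by (intro AE_finite_allI AE_integrable_convolution) auto
  then show ?thesis
  proof eventually_elim
    case (elim y)
    have "cl_coeff (cl_convolution p q f g y) T = (\<integral>x. (\<Sum>A\<in>?P. \<Sum>B\<in>?P.
        (if sym_diff A B = T then cl_sign p A B else 0) *
          (cl_coeff (f x) A * cl_coeff (g (y - x)) B)) \<partial>lebesgue)"
      by (simp only: cl_convolution_def lookup_cl_integral[OF assms(3)] lookup_cl_mult[OF fg(1,2)])
    also have "\<dots> = (\<Sum>A\<in>?P. \<Sum>B\<in>?P.
        (if sym_diff A B = T then cl_sign p A B else 0) *
         (\<integral>x. cl_coeff (f x) A * cl_coeff (g (y - x)) B \<partial>lebesgue))"
      using elim by (intro integral_double_sum) blast
    finally show ?case .
  qed
qed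

text \<open>Almost everywhere each coefficient is a finite linear combination of integrable scalar
  convolutions; completeness of Lebesgue measure absorbs the exceptional set.\<close>

lemma cl_convolution_in_L1:
  assumes "f \<in> cl_L1 p q" "g \<in> cl_L1 p q"
  shows "cl_convolution p q f g \<in> cl_L1 p q"
proof -
  have "integrable lebesgue (\<lambda>y. cl_coeff (cl_convolution p q f g y) T)"
    if "T \<in> Pow {1..p + q}" for T
    unfolding completion.integrable_cong_AE_iff[OF AE_lookup_convolution[OF assms that]]
    using assms by (intro Bochner_Integration.integrable_sum integrable_mult_right
      integrable_convolution) (auto simp: cl_L1_def)
  then show ?thesis
    by (simp add: cl_L1_def cl_convolution_def cl_integral_in_clifford)
qed

text \<open>After the substitution y = x + t, the identity \<open>add\<close> separates the
  variables and turns each double integral into a sum of two products of single integrals. It is the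
  common shape of the addition formulas for cosine and sine.\<close>

lemma cl_moment_convolution:
  assumes "f \<in> cl_L1 p q" "g \<in> cl_L1 p q"
    and bb: "h \<in> bounded_borel" "h1 \<in> bounded_borel" "h2 \<in> bounded_borel"
      "k1 \<in> bounded_borel" "k2 \<in> bounded_borel"
    and add: "\<And>x t. h (x + t) = h1 x * h2 t + k1 x * k2 t"
  shows "cl_moment p q h (cl_convolution p q f g) =
    cl_mult p (cl_moment p q h1 f) (cl_moment p q h2 g) +
    cl_mult p (cl_moment p q k1 f) (cl_moment p q k2 g)"
proof (rule clifford_eqI[of _ p q])
  let ?P = "Pow {1..p + q}"
  let ?f = "\<lambda>A x. cl_coeff (f x) A" and ?g = "\<lambda>A x. cl_coeff (g x) A"
  have fg: "A \<in> ?P \<Longrightarrow> integrable lebesgue (?f A)" "A \<in> ?P \<Longrightarrow> integrable lebesgue (?g A)" for A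
    using assms by (auto simp: cl_L1_def)
  note bounded = integrable_mult_bounded_borel
  obtain H where h: "h \<in> borel_measurable borel" and H: "\<And>y. \<bar>h y\<bar> \<le> H"
    using bb(1) by (auto simp: bounded_borel_def)
  have real_moment: "(\<integral>y. (\<integral>x. ?f A x * ?g B (y - x) \<partial>lebesgue) * h y \<partial>lebesgue) =
      (\<integral>x. ?f A x * h1 x \<partial>lebesgue) * (\<integral>x. ?g B x * h2 x \<partial>lebesgue) +
      (\<integral>x. ?f A x * k1 x \<partial>lebesgue) * (\<integral>x. ?g B x * k2 x \<partial>lebesgue)"
    (is "_ = _ * ?m2 + _ * ?n2") if AB: "A \<in> ?P" "B \<in> ?P" for A B
  proof -
    \<comment> \<open>For fixed \<open>x\<close> the values \<open>h1 x\<close> and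
      \<open>k1 x\<close> are constants, so the \<open>t\<close>-integral reduces to the two moments
      of the \<open>B\<close>-component of \<open>g\<close>.\<close>
    have inner: "(\<integral>t. ?g B t * h (x + t) \<partial>lebesgue) = h1 x * ?m2 + k1 x * ?n2" for x
    proof -
      have "(\<integral>t. ?g B t * h (x + t) \<partial>lebesgue) =
          (\<integral>t. h1 x * (?g B t * h2 t) + k1 x * (?g B t * k2 t) \<partial>lebesgue)"
        by (intro Bochner_Integration.integral_cong refl) (simp add: add distrib_left mult_ac)
      then show ?thesis
        using bounded[OF fg(2)[OF AB(2)]] bb by simp
    qed
    have "(\<integral>y. (\<integral>x. ?f A x * ?g B (y - x) \<partial>lebesgue) * h y \<partial>lebesgue) =
        (\<integral>x. ?f A x * h1 x * ?m2 + ?f A x * k1 x * ?n2 \<partial>lebesgue)"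
      unfolding integral_convolution_weighted[OF fg(1)[OF AB(1)] fg(2)[OF AB(2)] h H] inner
      by (simp add: algebra_simps)
    then show ?thesis
      using bounded[OF fg(1)[OF AB(1)]] bb by simp
  qed
  fix T assume T: "T \<in> ?P"
  let ?s = "\<lambda>A B. if sym_diff A B = T then cl_sign p A B else 0"
  have "cl_coeff (cl_moment p q h (cl_convolution p q f g)) T =
      (\<integral>y. cl_coeff (cl_convolution p q f g y) T * h y \<partial>lebesgue)"
    by (rule lookup_cl_moment[OF T])
  also have "\<dots> = (\<integral>y. (\<Sum>A\<in>?P. \<Sum>B\<in>?P.
      ?s A B * ((\<integral>x. ?f A x * ?g B (y - x) \<partial>lebesgue) * h y)) \<partial>lebesgue)"
    by (rule completion.integral_eq_AE)
       (use AE_lookup_convolution[OF assms(1,2) T] in eventually_elim,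
        simp add: sum_distrib_right mult.assoc)
  also have "\<dots> = (\<Sum>A\<in>?P. \<Sum>B\<in>?P.
      ?s A B * (\<integral>y. (\<integral>x. ?f A x * ?g B (y - x) \<partial>lebesgue) * h y \<partial>lebesgue))"
    by (intro integral_double_sum bounded integrable_convolution fg bb)
  also have "\<dots> = (\<Sum>A\<in>?P. \<Sum>B\<in>?P. ?s A B *
      (cl_coeff (cl_moment p q h1 f) A * cl_coeff (cl_moment p q h2 g) B +
       cl_coeff (cl_moment p q k1 f) A * cl_coeff (cl_moment p q k2 g) B))"
    by (intro sum.cong refl) (simp only: real_moment lookup_cl_moment)
  also have "\<dots> = cl_coeff (cl_mult p (cl_moment p q h1 f) (cl_moment p q h2 g) +
      cl_mult p (cl_moment p q k1 f) (cl_moment p q k2 g)) T"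
    by (simp only: lookup_add lookup_cl_mult[OF cl_moment_in_clifford cl_moment_in_clifford]
      distrib_left sum.distrib)
  finally show "cl_coeff (cl_moment p q h (cl_convolution p q f g)) T =
      cl_coeff (cl_mult p (cl_moment p q h1 f) (cl_moment p q h2 g) +
        cl_mult p (cl_moment p q k1 f) (cl_moment p q k2 g)) T" .
qed (simp_all add: cl_moment_in_clifford cl_add_in_clifford cl_mult_in_clifford)

section \<open>Blade expansion and the convolution theorem\<close>

text \<open>Associativity pulls \<open>u\<close> out of the sum, leaving the expansion of
  \<open>v\<close> in the blade basis.\<close>

lemma sum_blade_scalar_right:
  assumes "u \<in> clifford p q" "v \<in> clifford p q"
  shows "(\<Sum>S\<in>Pow {1..p + q}. cl_mult p (cl_mult p u (cl_blade p S)) (cl_real (cl_coeff v S))) =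
    cl_mult p u v"
proof -
  have "(\<Sum>S\<in>Pow {1..p + q}. cl_mult p (cl_mult p u (cl_blade p S)) (cl_real (cl_coeff v S))) =
      cl_mult p u (\<Sum>S\<in>Pow {1..p + q}. cl_mult p (cl_blade p S) (cl_real (cl_coeff v S)))"
    unfolding cl_mult_sum_right
    by (intro sum.cong refl cl_mult_assoc[of _ p q] assms cl_blade_in_clifford cl_real_in_clifford)
  also have "(\<Sum>S\<in>Pow {1..p + q}. cl_mult p (cl_blade p S) (cl_real (cl_coeff v S))) = v"
    using cl_blade_expansion[OF assms(2), of "cl_coeff v"] by simp
  finally show ?thesis .
qed

theorem proposition3p3:
  fixes p q :: nat and \<mu> :: multivector and f g :: "real \<Rightarrow> multivector" and \<xi> :: real
  assumes "\<mu> \<in> clifford p q"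
    and "cl_mult p \<mu> \<mu> = - cl_real 1"
    and "f \<in> cl_L1 p q"
    and "g \<in> cl_L1 p q"
  shows "cl_fourier p q \<mu> (cl_convolution p q f g) \<xi> =
    (\<Sum>S\<in>Pow {1..p + q}.
       cl_mult p (cl_fourier p q \<mu> (\<lambda>x. cl_mult p (f x) (cl_blade p S)) \<xi>)
                 (cl_fourier p q \<mu> (\<lambda>x. cl_real (cl_coeff (g x) S)) \<xi>))"
proof -
  let ?P = "Pow {1..p + q}"
  let ?cos = "\<lambda>x. cos (x * \<xi>)" and ?sin = "\<lambda>x. sin (x * \<xi>)"
  define Cf Sf Cg Sg where moments: "Cf = cl_moment p q ?cos f" "Sf = cl_moment p q ?sin f"
    "Cg = cl_moment p q ?cos g" "Sg = cl_moment p q ?sin g"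
  have mem: "Cf \<in> clifford p q" "Sf \<in> clifford p q" "Cg \<in> clifford p q" "Sg \<in> clifford p q"
    by (simp_all add: moments cl_moment_in_clifford)
  \<comment> \<open>The minus sign in the addition formula for the cosine is absorbed into the first
    sine weight, since \<open>cl_moment_convolution\<close> expects a sum.\<close>
  have cos_conv: "cl_moment p q ?cos (cl_convolution p q f g) = cl_mult p Cf Cg - cl_mult p Sf Sg"
    using cl_moment_convolution[OF assms(3,4), of ?cos ?cos ?cos "\<lambda>x. - sin (x * \<xi>)" ?sin]
    by (simp add: bounded_borel_trig distrib_right cos_add cl_moment_minus cl_mult_minus_left moments)
  have sin_conv: "cl_moment p q ?sin (cl_convolution p q f g) = cl_mult p Sf Cg + cl_mult p Cf Sg"
    using cl_moment_convolution[OF assms(3,4), of ?sin ?sin ?cos ?cos ?sin]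
    by (simp add: bounded_borel_trig distrib_right sin_add moments)
  \<comment> \<open>This form keeps each blade next to its real coefficient, with a single trailing
    \<open>\<mu>\<close>, so that every piece can be summed by
    \<open>sum_blade_scalar_right\<close>.\<close>
  have summand: "cl_mult p (cl_fourier p q \<mu> (\<lambda>x. cl_mult p (f x) (cl_blade p S)) \<xi>)
        (cl_fourier p q \<mu> (\<lambda>x. cl_real (cl_coeff (g x) S)) \<xi>) =
      cl_mult p (cl_mult p Cf (cl_blade p S)) (cl_real (cl_coeff Cg S)) -
      cl_mult p (cl_mult p Sf (cl_blade p S)) (cl_real (cl_coeff Sg S)) +
      cl_mult p (cl_mult p (cl_mult p Sf (cl_blade p S)) (cl_real (cl_coeff Cg S)) +
                 cl_mult p (cl_mult p Cf (cl_blade p S)) (cl_real (cl_coeff Sg S))) \<mu>"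
    if S: "S \<in> ?P" for S
  proof -
    note eS = cl_blade_in_clifford[OF S]
    have G: "cl_fourier p q \<mu> (\<lambda>x. cl_real (cl_coeff (g x) S)) \<xi> =
        cl_real (cl_coeff Cg S) + cl_mult p (cl_real (cl_coeff Sg S)) \<mu>"
      using assms(1,4) S by (simp add: cl_fourier_moments cl_real_coeff_in_L1 cl_moment_real moments del: Pow_iff)
    have F: "cl_fourier p q \<mu> (\<lambda>x. cl_mult p (f x) (cl_blade p S)) \<xi> =
        cl_mult p Cf (cl_blade p S) + cl_mult p (cl_mult p Sf (cl_blade p S)) \<mu>"
      using assms(1,3) eS
      by (simp add: cl_fourier_moments cl_mult_const_in_L1 cl_moment_mult_const bounded_borel_trig
        moments)
    \<comment> \<open>Neither \<open>u\<close> nor \<open>v\<close> has to commute with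
      \<open>\<mu>\<close>: in the second factor \<open>\<mu>\<close> is accompanied only by real
      scalars.\<close>
    have expand: "cl_mult p (u + cl_mult p v \<mu>) (cl_real c + cl_mult p (cl_real s) \<mu>) =
        cl_mult p u (cl_real c) - cl_mult p v (cl_real s) +
        cl_mult p (cl_mult p v (cl_real c) + cl_mult p u (cl_real s)) \<mu>"
      if uv: "u \<in> clifford p q" "v \<in> clifford p q" for u v c s
    proof -
      note in_cl = uv assms(1) cl_real_in_clifford cl_mult_in_clifford
      have "cl_mult p u (cl_mult p (cl_real s) \<mu>) = cl_mult p (cl_mult p u (cl_real s)) \<mu>"
        by (simp add: cl_mult_assoc[of _ p q] in_cl)
      \<comment> \<open>The two copies of \<open>\<mu>\<close> meet once the scalar \<open>s\<close>
        is moved out from between them; their product -1 gives the sign.\<close>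
      moreover have "cl_mult p (cl_mult p v \<mu>) (cl_mult p (cl_real s) \<mu>) =
          - cl_mult p v (cl_real s)"
      proof -
        have "cl_mult p (cl_mult p v \<mu>) (cl_mult p (cl_real s) \<mu>) =
            cl_mult p (cl_mult p (cl_mult p v \<mu>) (cl_real s)) \<mu>"
          by (simp add: cl_mult_assoc[of _ p q] in_cl)
        also have "\<dots> = cl_mult p (cl_mult p v (cl_real s)) (cl_mult p \<mu> \<mu>)"
          unfolding cl_mult_real_swap[OF uv(2) assms(1)]
          by (rule cl_mult_assoc[of _ p q]) (simp_all add: in_cl)
        finally show ?thesis by (simp add: assms(2) cl_mult_minus_right)
      qed
      moreover have "cl_mult p (cl_mult p v \<mu>) (cl_real c) = cl_mult p (cl_mult p v (cl_real c)) \<mu>"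
        by (rule cl_mult_real_swap[OF uv(2) assms(1)])
      ultimately show ?thesis
        by (simp add: cl_mult_add_left cl_mult_add_right)
    qed
    show ?thesis
      unfolding F G using mem eS by (intro expand cl_mult_in_clifford)
  qed
  \<comment> \<open>The blade sums restore \<open>Cg\<close> and \<open>Sg\<close>, and the result
    is the cosine transform of the convolution plus its sine transform times
    \<open>\<mu>\<close>.\<close>
  have "(\<Sum>S\<in>?P. cl_mult p (cl_fourier p q \<mu> (\<lambda>x. cl_mult p (f x) (cl_blade p S)) \<xi>)
        (cl_fourier p q \<mu> (\<lambda>x. cl_real (cl_coeff (g x) S)) \<xi>)) =
      cl_mult p Cf Cg - cl_mult p Sf Sg + cl_mult p (cl_mult p Sf Cg + cl_mult p Cf Sg) \<mu>"
    using mem by (simp add: summand sum.distrib sum_subtractf sum_blade_scalar_right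
      flip: cl_mult_sum_left del: Pow_iff One_nat_def)
  then show ?thesis
    by (simp add: cl_fourier_moments[OF cl_convolution_in_L1[OF assms(3,4)] assms(1)]
      cos_conv sin_conv)
qed

end
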